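(* Let $X_1,\dots,X_m$ be independent and identically distributed from $F$, an absolutely continuous unimodal distribution on $\mathbb{R}$ with density $f$ and a unique mode $\theta_0$. Split the sample into two disjoint, almost equally sized sub-samples $S_1$ and $S_2$ with $|S_1|=m-n$, $|S_2|=n$, and let $\widehat\theta_1$ be any consistent estimate of the mode computed from $S_1$ only. For $\theta\in\mathbb{R}$ and $X_i\in S_2$ let $$p_i(\theta)=\frac{2}{1+\left|\frac{X_i-\theta}{X_i-\widehat\theta_1}\right|},$$ and for $\alpha\in(0,1)$ let $$\widehat{\mathrm{CS}}_{n,\alpha}^{\mathrm{Ed}_p}=\left\{\theta\in\mathbb{R}\;:\;-2\sum_{i:X_i\in S_2}\log(p_i(\theta))<\chi^2(1-\alpha,2n)\right\}.$$ Then for all $n\ge1$ and all $\alpha\in(0,1)$, $$\mathbb{P}_F\big(\theta_0\in\widehat{\mathrm{CS}}_{n,\alpha}^{\mathrm{Ed}_p}\big)\ge1-\alpha.$$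
   Context: Unimodal with mode $\theta_0$: $F$ is convex on $(-\infty,\theta_0]$ and concave on $[\theta_0,\infty)$. $\chi^2(1-\alpha,2n)$ denotes the $(1-\alpha)$-quantile of the chi-squared distribution with $2n$ degrees of freedom. *)

theory Defs
  imports "HOL-Probability.Probability"
begin

definition unimodal_at :: "real measure \<Rightarrow> real \<Rightarrow> bool" where
  "unimodal_at D \<theta> \<longleftrightarrow> convex_on {..\<theta>} (cdf D) \<and> concave_on {\<theta>..} (cdf D)"

(* Meaningful for k > 0. *)
definition chi_squared_density :: "nat \<Rightarrow> real \<Rightarrow> real" where
  "chi_squared_density k x =
     (if x \<le> 0 then 0
      else x powr (real k / 2 - 1) * exp (- x / 2) / (2 powr (real k / 2) * Gamma (real k / 2)))"

definition chi_squared :: "nat \<Rightarrow> real measure" where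
  "chi_squared k = density lborel (\<lambda>x. ennreal (chi_squared_density k x))"

definition quantile :: "real measure \<Rightarrow> real \<Rightarrow> real" where
  "quantile D p = Inf {x. p \<le> cdf D x}"

(* An estimator maps a finite sample, given as a list of observations, to a real number. *)
definition estimator :: "(real list \<Rightarrow> real) \<Rightarrow> bool" where
  "estimator T \<longleftrightarrow>
     (\<forall>k. (\<lambda>x. T (map x [0..<k])) \<in> borel_measurable (PiM {..<k} (\<lambda>_. borel)))"

(* Convergence in probability to \<theta> when the sample size k of the i.i.d. sample from D,
   realised as the coordinates of the k-fold product measure, tends to infinity. *)
definition consistent_at :: "(real list \<Rightarrow> real) \<Rightarrow> real measure \<Rightarrow> real \<Rightarrow> bool" where
  "consistent_at T D \<theta> \<longleftrightarrow>
     (\<forall>\<epsilon>>0. (\<lambda>k. measure (PiM {..<k} (\<lambda>_. D))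
        {x \<in> space (PiM {..<k} (\<lambda>_. D)). \<epsilon> < \<bar>T (map x [0..<k]) - \<theta>\<bar>}) \<longlonglongrightarrow> 0)"

(* The subsample of x with indices in S, listed in increasing order of the index. *)
definition subsample :: "nat set \<Rightarrow> (nat \<Rightarrow> real) \<Rightarrow> real list" where
  "subsample S x = map x (sorted_list_of_set S)"

(* x is the observation and a the pilot estimate. If x = a, division by zero makes the value 2;
   for an absolutely continuous law and a independent of x this is a null event. *)
definition edelman_p :: "real \<Rightarrow> real \<Rightarrow> real \<Rightarrow> real" where
  "edelman_p a \<theta> x = 2 / (1 + \<bar>(x - \<theta>) / (x - a)\<bar>)"

definition edelman_CS :: "real \<Rightarrow> nat set \<Rightarrow> nat \<Rightarrow> real \<Rightarrow> (nat \<Rightarrow> real) \<Rightarrow> real set" where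
  "edelman_CS a S n \<alpha> x =
     {\<theta>. - 2 * (\<Sum>i\<in>S. ln (edelman_p a \<theta> (x i))) < quantile (chi_squared (2 * n)) (1 - \<alpha>)}"

end

theory Submission
  imports Defs
begin

text \<open>Condition on the first sub-sample, so that the pilot estimate is a constant \<open>a\<close>. Unimodality then
  bounds the lower tail of each \<open>p\<^sub>i(\<theta>\<^sub>0)\<close> by that of a uniform variable, whence \<open>- 2 ln p\<^sub>i(\<theta>\<^sub>0)\<close> is
  stochastically dominated by an exponential variable of rate \<open>1/2\<close>. Dominance is preserved by
  convolution, and the sum of \<open>n\<close> such exponentials is chi-squared with \<open>2n\<close> degrees of freedom.\<close>

section \<open>Stochastic dominance and convolution\<close>

text \<open>By Fubini, the convolution's tail at \<open>s\<close> is the \<open>N\<close>-average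
  over \<open>x\<close> of the tail of the other factor at \<open>s - x\<close>, so pointwise
  dominance survives integration.\<close>

lemma convolution_upper_tail_mono_left:
  fixes D D' N :: "real measure"
  assumes fin: "finite_measure D" "finite_measure D'" "finite_measure N"
    and sets: "sets D = sets borel" "sets D' = sets borel" "sets N = sets borel"
    and le: "\<And>s. emeasure D {s..} \<le> emeasure D' {s..}"
  shows "emeasure (D \<star> N) {s..} \<le> emeasure (D' \<star> N) {s..}"
proof -
  have conv: "emeasure (E \<star> N) {s..} = (\<integral>\<^sup>+x. emeasure E {s - x..} \<partial>N)"
    if "finite_measure E" "sets E = sets borel" for E :: "real measure"
  proof -
    have space: "space E = UNIV" "space N = UNIV"
      using sets_eq_imp_space_eq[OF that(2)] sets_eq_imp_space_eq[OF sets(3)] by simp_all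
    have "emeasure (N \<star> E) {s..} = (\<integral>\<^sup>+x. emeasure E {y. y + x \<in> {s..}} \<partial>N)"
      using that fin sets space by (intro convolution_emeasure) auto
    moreover have "{y. y + x \<in> {s..}} = {s - x..}" for x :: real
      by auto
    ultimately show ?thesis
      using convolution_commutative[OF that(1) fin(3) sets(3) that(2)] by simp
  qed
  show ?thesis
    unfolding conv[OF fin(1) sets(1)] conv[OF fin(2) sets(2)]
    by (intro nn_integral_mono le)
qed

text \<open>One factor is exchanged at a time; commutativity moves the second factor into the
  position that the one-sided version treats.\<close>

lemma convolution_upper_tail_mono:
  fixes D D' N N' :: "real measure"
  assumes fin: "finite_measure D" "finite_measure D'" "finite_measure N" "finite_measure N'"
    and sets: "sets D = sets borel" "sets D' = sets borel" "sets N = sets borel" "sets N' = sets borel"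
    and le: "\<And>s. emeasure D {s..} \<le> emeasure D' {s..}" "\<And>s. emeasure N {s..} \<le> emeasure N' {s..}"
  shows "emeasure (D \<star> N) {s..} \<le> emeasure (D' \<star> N') {s..}"
proof -
  have "emeasure (D \<star> N) {s..} \<le> emeasure (D' \<star> N) {s..}"
    by (rule convolution_upper_tail_mono_left) (use fin sets le in auto)
  also have "\<dots> = emeasure (N \<star> D') {s..}"
    using convolution_commutative[OF fin(2,3)] sets by simp
  also have "\<dots> \<le> emeasure (N' \<star> D') {s..}"
    by (rule convolution_upper_tail_mono_left) (use fin sets le in auto)
  also have "\<dots> = emeasure (D' \<star> N') {s..}"
    using convolution_commutative[OF fin(2,4)] sets by simp
  finally show ?thesis .
qed

text \<open>\<open>erlang_density k\<close> has shape parameter \<open>k + 1\<close>. Shapes add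
  under convolution, which accounts for the \<open>Suc\<close>.\<close>

lemma density_erlang_convolution:
  assumes "0 < l"
  shows "density lborel (erlang_density j l) \<star> density lborel (erlang_density k l) =
    density lborel (erlang_density (Suc (j + k)) l)"
proof -
  have "finite_measure (density lborel (erlang_density i l))" for i
    using prob_space_erlang_density[OF assms] by (rule prob_space.finite_measure)
  then show ?thesis
    by (simp add: convolution_density convolution_erlang_density[OF assms])
qed

text \<open>Induction on \<open>I\<close>: independence makes the law of the enlarged sum a
  convolution, and both factors are dominated. The index is \<open>card I - 1\<close> because index
  0 is already one exponential variable.\<close>

lemma (in prob_space) sum_indep_upper_tail_le_erlang:
  assumes I: "finite I" "I \<noteq> {}" and l: "0 < l"
    and ind: "indep_vars (\<lambda>_. borel) Y I"
    and tail: "\<And>i s. i \<in> I \<Longrightarrow>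
      emeasure (distr M borel (Y i)) {s..} \<le> emeasure (density lborel (exponential_density l)) {s..}"
  shows "emeasure (distr M borel (\<lambda>\<omega>. \<Sum>i\<in>I. Y i \<omega>)) {s..} \<le>
    emeasure (density lborel (erlang_density (card I - 1) l)) {s..}"
  using I ind tail
proof (induction I arbitrary: s rule: finite_ne_induct)
  case (singleton i)
  then show ?case by simp
next
  case (insert i I)
  have ind: "indep_vars (\<lambda>_. borel) Y I"
    using insert.prems(1) by (rule indep_vars_subset) auto
  have rv: "\<And>j. j \<in> insert i I \<Longrightarrow> random_variable borel (Y j)"
    using insert.prems(1) by (auto simp: indep_vars_def)
  have rvs: "random_variable borel (\<lambda>\<omega>. \<Sum>i\<in>I. Y i \<omega>)"
    using rv by (intro borel_measurable_sum) auto
  have fin: "finite_measure (distr M borel Z)" if "random_variable borel Z" for Z :: "'a \<Rightarrow> real"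
    using prob_space_distr[OF that] by (rule prob_space.finite_measure)
  have fin': "finite_measure (density lborel (erlang_density k l))" for k
    using prob_space_erlang_density[OF l] by (rule prob_space.finite_measure)
  have "emeasure (distr M borel (\<lambda>\<omega>. \<Sum>i\<in>insert i I. Y i \<omega>)) {s..} =
      emeasure (distr M borel (Y i) \<star> distr M borel (\<lambda>\<omega>. \<Sum>i\<in>I. Y i \<omega>)) {s..}"
    using insert.hyps rv rvs indep_vars_sum[OF insert.hyps(1,3) insert.prems(1)]
    by (subst sum_indep_random_variable[symmetric]) auto
  also have "\<dots> \<le> emeasure (density lborel (exponential_density l) \<star>
      density lborel (erlang_density (card I - 1) l)) {s..}"
  proof (rule convolution_upper_tail_mono)
    show "emeasure (distr M borel (\<lambda>\<omega>. \<Sum>i\<in>I. Y i \<omega>)) {s..} \<le>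
        emeasure (density lborel (erlang_density (card I - 1) l)) {s..}" for s
      using insert.prems(2) by (intro insert.IH ind) auto
  qed (use insert.prems fin fin' rv rvs in auto)
  also have "\<dots> = emeasure (density lborel (erlang_density (card (insert i I) - 1) l)) {s..}"
    using insert.hyps card_gt_0_iff[of I] by (simp add: density_erlang_convolution[OF l])
  finally show ?case .
qed

lemma emeasure_exponential_upper_tail:
  assumes l: "0 < l"
  shows "emeasure (density lborel (exponential_density l)) {s..} =
    ennreal (if s \<le> 0 then 1 else exp (- l * s))"
proof -
  let ?E = "density lborel (exponential_density l)"
  interpret E: prob_space ?E
    using l by (rule prob_space_exponential_density)
  \<comment> \<open>The CDF yields the open tail beyond \<open>s\<close>; the closed tail differs
    from it by the null set \<open>{s}\<close>.\<close>
  have "emeasure ?E {s} = 0"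
    by (subst emeasure_density) (auto intro!: nn_integral_null_set)
  then have "E.prob {s} = 0"
    by (simp add: measure_def)
  moreover have "E.prob ({s} \<union> (space ?E - {..s})) = E.prob {s} + E.prob (space ?E - {..s})"
    by (rule E.finite_measure_Union) auto
  moreover have "{s} \<union> (space ?E - {..s}) = {s..}"
    by auto
  ultimately have "E.prob {s..} = E.prob (space ?E - {..s})"
    by simp
  also have "\<dots> = 1 - E.prob {..s}"
    by (rule E.prob_compl) simp
  also have "E.prob {..s} = erlang_CDF 0 l s"
    using emeasure_erlang_density[OF l, of 0 s] l by (simp add: measure_def)
  finally show ?thesis
    by (auto simp: E.emeasure_eq_measure erlang_CDF_0)
qed

section \<open>The chi-squared quantile\<close>

text \<open>For an even number of degrees of freedom the Gamma value is a factorial and the real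
  powers are natural powers, leaving an Erlang density of rate \<open>1 / 2\<close>.\<close>

lemma chi_squared_even_eq_erlang:
  assumes "1 \<le> n"
  shows "chi_squared (2 * n) = density lborel (erlang_density (n - 1) (1 / 2))"
proof -
  obtain k where n: "n = Suc k"
    using assms by (cases n) auto
  have half: "real (2 * n) / 2 = real n"
    by simp
  have "Gamma (real n) = fact k"
    using Gamma_fact[of k, where 'a = real] n by (simp add: add.commute)
  moreover have "x powr (real n - 1) = x ^ k" if "0 < x" for x :: real
    using that n by (simp add: powr_realpow)
  moreover have "(2 :: real) powr real n = 2 ^ n"
    by (rule powr_realpow) simp
  \<comment> \<open>The point 0 is left out: for \<open>n = 1\<close> the Erlang density is
    \<open>1 / 2\<close> there, but \<open>chi_squared_density\<close> is 0. Equality almost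
    everywhere suffices.\<close>
  ultimately have "chi_squared_density (2 * n) x = erlang_density (n - 1) (1 / 2) x" if "x \<noteq> 0" for x
    using that n unfolding chi_squared_density_def half
    by (simp add: erlang_density_def power_divide)
  moreover have "chi_squared_density (2 * n) \<in> borel_measurable borel"
    unfolding chi_squared_density_def[abs_def] by measurable
  ultimately show ?thesis
    unfolding chi_squared_def
    by (intro density_cong) (auto intro: AE_mp[OF AE_lborel_singleton[of 0]])
qed

text \<open>Every point to the right of the infimum has cdf at least \<open>p\<close>, by
  monotonicity; right continuity carries the bound to the infimum itself.\<close>

lemma (in real_distribution) le_cdf_quantile:
  assumes "0 < p" "p < 1"
  shows "p \<le> cdf M (quantile M p)"
proof -
  let ?A = "{x. p \<le> cdf M x}"
  have "eventually (\<lambda>x. cdf M x > p) at_top"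
    using cdf_lim_at_top_prob assms(2) by (rule order_tendstoD)
  then have ne: "?A \<noteq> {}"
    by (auto simp: eventually_at_top_linorder intro: less_imp_le)
  have "eventually (\<lambda>x. cdf M x < p) at_bot"
    using cdf_lim_at_bot assms(1) by (rule order_tendstoD)
  then obtain b where b: "\<And>x. x \<le> b \<Longrightarrow> cdf M x < p"
    by (auto simp: eventually_at_bot_linorder)
  have above: "p \<le> cdf M x" if "quantile M p < x" for x
  proof -
    obtain y where "y \<in> ?A" "y < x"
      using cInf_lessD[OF ne] \<open>quantile M p < x\<close> by (auto simp: quantile_def)
    then show ?thesis
      using cdf_nondecreasing[of y x] by simp
  qed
  have "(cdf M \<longlongrightarrow> cdf M (quantile M p)) (at_right (quantile M p))"
    using cdf_is_right_cont by (simp add: continuous_within)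
  moreover have "eventually (\<lambda>x. p \<le> cdf M x) (at_right (quantile M p))"
    using above by (auto simp: eventually_at_right_field intro!: exI[of _ "quantile M p + 1"])
  ultimately show ?thesis
    by (rule tendsto_lowerbound) simp
qed

section \<open>Edelman's inequality\<close>

lemma edelman_p_pos: "0 < edelman_p a \<theta> x"
  by (auto simp: edelman_p_def intro!: divide_pos_pos add_pos_nonneg)

lemma edelman_p_measurable [measurable]:
  assumes [measurable]: "g \<in> borel_measurable N" "h \<in> borel_measurable N"
  shows "(\<lambda>z. edelman_p (g z) \<theta> (h z)) \<in> borel_measurable N"
  unfolding edelman_p_def by measurable

text \<open>Clearing denominators gives the claim. It is phrased through the offsets
  \<open>x - \<theta>\<close> and \<open>a - \<theta>\<close> so that reflection about \<theta> is a
  mere change of sign.\<close>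

lemma edelman_p_leD:
  assumes "0 < t" "t < 1" "edelman_p a \<theta> x \<le> t"
  shows "(2 - t) * \<bar>(x - \<theta>) - (a - \<theta>)\<bar> \<le> t * \<bar>x - \<theta>\<bar>"
proof -
  \<comment> \<open>At \<open>x = a\<close> division by zero makes the p-value 2, which exceeds
    \<open>t\<close>.\<close>
  have "x \<noteq> a"
    using assms by (auto simp: edelman_p_def)
  then have "edelman_p a \<theta> x = 2 * \<bar>x - a\<bar> / (\<bar>x - a\<bar> + \<bar>x - \<theta>\<bar>)"
    by (simp add: edelman_p_def abs_divide field_simps)
  moreover have "0 < \<bar>x - a\<bar> + \<bar>x - \<theta>\<bar>"
    using \<open>x \<noteq> a\<close> by auto
  ultimately have "2 * \<bar>x - a\<bar> \<le> t * (\<bar>x - a\<bar> + \<bar>x - \<theta>\<bar>)"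
    using assms(3) by (simp add: divide_le_eq)
  then show ?thesis
    by (simp add: algebra_simps)
qed

text \<open>For \<open>\<theta> < a\<close> the event lies in an interval \<open>[l, u]\<close> with \<open>l = t \<theta> + (1 - t) u\<close>; there
  concavity of the distribution function gives \<open>cdf l \<ge> (1 - t) cdf u\<close>. The case \<open>a < \<theta>\<close> is
  symmetric, and for \<open>a = \<theta>\<close> the event is empty.\<close>

lemma (in real_distribution) edelman_inequality:
  assumes unimodal: "unimodal_at M \<theta>" and atomless: "\<And>x. measure M {x} = 0"
    and t: "0 < t" "t < 1"
  shows "measure M {x. edelman_p a \<theta> x \<le> t} \<le> t"
proof -
  define d where "d = a - \<theta>"
  \<comment> \<open>With \<open>z = x - \<theta>\<close>, the points \<open>l\<close> and
    \<open>u\<close> solve \<open>(2 - t) * \<bar>z - d\<bar> = t * \<bar>z\<bar>\<close>: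
    \<open>l\<close> with \<open>z\<close> between 0 and \<open>d\<close>, \<open>u\<close> with
    \<open>z\<close> beyond \<open>d\<close>. For negative \<open>d\<close> their order is
    reversed.\<close>
  define l where "l = \<theta> + d * (2 - t) / 2"
  define u where "u = \<theta> + d * (2 - t) / (2 * (1 - t))"
  have lu: "l = (1 - (1 - t)) *\<^sub>R \<theta> + (1 - t) *\<^sub>R u"
    using t by (simp add: l_def u_def field_simps)
  have Icc: "measure M {b..c} = cdf M c - cdf M b" if "b < c" for b c
  proof -
    have "measure M ({b} \<union> {b<..c}) = measure M {b} + measure M {b<..c}"
      by (rule finite_measure_Union) auto
    moreover have "{b} \<union> {b<..c} = {b..c}"
      using that by auto
    ultimately show ?thesis
      using that by (simp add: atomless cdf_diff_eq)
  qed
  have event: "(2 - t) * \<bar>(x - \<theta>) - d\<bar> \<le> t * \<bar>x - \<theta>\<bar>" if "edelman_p a \<theta> x \<le> t" for x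
    using edelman_p_leD[OF t that] by (simp add: d_def)
  have interval: "d * (2 - t) \<le> 2 * z \<and> 2 * (1 - t) * z \<le> d * (2 - t)"
    if "0 < d" "(2 - t) * \<bar>z - d\<bar> \<le> t * \<bar>z\<bar>" for z d
  proof -
    have 1: "(2 - t) * (d - z) \<le> t * \<bar>z\<bar>" "(2 - t) * (z - d) \<le> t * \<bar>z\<bar>"
      using that(2) t mult_left_mono[of "d - z" "\<bar>z - d\<bar>" "2 - t"]
        mult_left_mono[of "z - d" "\<bar>z - d\<bar>" "2 - t"] by linarith+
    have "0 < (2 - t) * d"
      using that t by simp
    \<comment> \<open>A negative \<open>z\<close> would give
      \<open>(2 - t) * d \<le> 2 * (1 - t) * z < 0\<close>, contradicting the sign of
      \<open>d\<close>.\<close>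
    have "0 \<le> z"
    proof (rule ccontr)
      assume "\<not> 0 \<le> z"
      then have "(2 - t) * d \<le> (2 * (1 - t)) * z"
        using 1(1) by (simp add: algebra_simps)
      moreover have "(2 * (1 - t)) * z < 0"
        using t \<open>\<not> 0 \<le> z\<close> by (intro mult_pos_neg) auto
      ultimately show False
        using \<open>0 < (2 - t) * d\<close> by linarith
    qed
    then show ?thesis
      using 1 by (simp add: algebra_simps)
  qed
  consider "d = 0" | "0 < d" | "d < 0"
    by linarith
  then show ?thesis
  proof cases
    case 1
    \<comment> \<open>With \<open>a = \<theta>\<close> the ratio is 1 away from \<open>a\<close>, so
      the p-value is 1 there and 2 at \<open>a\<close>.\<close>
    have "\<not> edelman_p a \<theta> x \<le> t" for x
      using 1 t by (cases "x = a") (auto simp: d_def edelman_p_def)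
    then show ?thesis
      using t by simp
  next
    case 2
    have "x \<in> {l..u}" if "edelman_p a \<theta> x \<le> t" for x
      using interval[OF 2 event[OF that]] t by (auto simp: l_def u_def field_simps)
    then have "measure M {x. edelman_p a \<theta> x \<le> t} \<le> measure M {l..u}"
      by (intro finite_measure_mono) auto
    also have "\<dots> = cdf M u - cdf M l"
      using 2 t by (intro Icc) (auto simp: l_def u_def field_simps)
    also have "\<dots> \<le> t"
    proof -
      \<comment> \<open>Concavity bounds \<open>cdf M u - cdf M l\<close> by
        \<open>t * (cdf M u - cdf M \<theta>)\<close>, which is at most \<open>t\<close>.\<close>
      have "(1 - (1 - t)) * cdf M \<theta> + (1 - t) * cdf M u \<le> cdf M l"
        unfolding lu using unimodal t 2
        by (intro concave_onD[of "{\<theta>..}"]) (auto simp: unimodal_at_def u_def)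
      moreover have "0 \<le> t * cdf M \<theta>" "t * cdf M u \<le> t * 1"
        using t cdf_nonneg cdf_bounded_prob by (auto intro: mult_left_mono)
      ultimately show ?thesis
        by (simp add: algebra_simps)
    qed
    finally show ?thesis .
  next
    case 3
    have "x \<in> {u..l}" if "edelman_p a \<theta> x \<le> t" for x
      \<comment> \<open>Reflecting both offsets reduces negative \<open>d\<close> to the positive
        case.\<close>
      using interval[of "- d" "- (x - \<theta>)"] event[OF that] 3 t
      by (auto simp: l_def u_def field_simps abs_minus_commute)
    then have "measure M {x. edelman_p a \<theta> x \<le> t} \<le> measure M {u..l}"
      by (intro finite_measure_mono) auto
    also have "\<dots> = cdf M l - cdf M u"
      using 3 t by (intro Icc) (auto simp: l_def u_def field_simps)
    also have "\<dots> \<le> t"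
    proof -
      have "cdf M l \<le> (1 - (1 - t)) * cdf M \<theta> + (1 - t) * cdf M u"
        unfolding lu using unimodal t 3
        by (intro convex_onD[of "{..\<theta>}"]) (auto simp: unimodal_at_def u_def field_simps mult_nonpos_nonneg)
      moreover have "0 \<le> t * cdf M u" "t * cdf M \<theta> \<le> t * 1"
        using t cdf_nonneg cdf_bounded_prob by (auto intro: mult_left_mono)
      ultimately show ?thesis
        by (simp add: algebra_simps)
    qed
    finally show ?thesis .
  qed
qed

text \<open>For positive \<open>s\<close> this is Edelman's inequality at
  \<open>t = exp (- s / 2)\<close>, which is also the exponential tail at \<open>s\<close>. For
  other \<open>s\<close> the exponential tail is 1.\<close>

lemma (in real_distribution) edelman_log_upper_tail:
  assumes "unimodal_at M \<theta>" and "\<And>x. measure M {x} = 0"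
  shows "emeasure (distr M borel (\<lambda>x. - 2 * ln (edelman_p a \<theta> x))) {s..} \<le>
    emeasure (density lborel (exponential_density (1 / 2))) {s..}"
proof (cases "s \<le> 0")
  case True
  then show ?thesis
    by (simp add: emeasure_exponential_upper_tail prob_space.emeasure_le_1 prob_space_distr)
next
  case False
  have "s \<le> - 2 * ln (edelman_p a \<theta> x) \<longleftrightarrow> edelman_p a \<theta> x \<le> exp (- s / 2)" for x
    using ln_le_cancel_iff[OF edelman_p_pos exp_gt_zero, of a \<theta> x "- s / 2"] by auto
  then have "(\<lambda>x. - 2 * ln (edelman_p a \<theta> x)) -` {s..} \<inter> space M =
      {x. edelman_p a \<theta> x \<le> exp (- s / 2)}"
    by auto
  then have "emeasure (distr M borel (\<lambda>x. - 2 * ln (edelman_p a \<theta> x))) {s..} =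
      measure M {x. edelman_p a \<theta> x \<le> exp (- s / 2)}"
    by (subst emeasure_distr) (auto simp: emeasure_eq_measure)
  also have "\<dots> \<le> exp (- s / 2)"
    using False by (intro ennreal_leI edelman_inequality assms) auto
  finally show ?thesis
    using False by (simp add: emeasure_exponential_upper_tail)
qed

section \<open>Coverage\<close>

text \<open>This replaces conditioning on \<open>A\<close>: under independence the joint law is a
  product, and a bound valid for each frozen value \<open>a\<close> integrates to the same
  bound.\<close>

lemma (in prob_space) prob_indep_ge:
  assumes ind: "indep_var N A K B" and Q: "Q \<in> sets (N \<Otimes>\<^sub>M K)"
    and ge: "\<And>a. a \<in> space N \<Longrightarrow> c \<le> prob {\<omega> \<in> space M. (a, B \<omega>) \<in> Q}"
  shows "c \<le> prob {\<omega> \<in> space M. (A \<omega>, B \<omega>) \<in> Q}"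
proof -
  have [measurable]: "random_variable N A" "random_variable K B"
    using ind by (blast dest: indep_var_rv1 indep_var_rv2)+
  note Q [measurable]
  interpret N: prob_space "distr M N A" by (rule prob_space_distr) simp
  interpret K: prob_space "distr M K B" by (rule prob_space_distr) simp
  have "emeasure M {\<omega> \<in> space M. (A \<omega>, B \<omega>) \<in> Q} = emeasure (distr M (N \<Otimes>\<^sub>M K) (\<lambda>\<omega>. (A \<omega>, B \<omega>))) Q"
    by (subst emeasure_distr) (auto intro!: arg_cong[where f = "emeasure M"])
  also have "\<dots> = emeasure (distr M N A \<Otimes>\<^sub>M distr M K B) Q"
    using ind by (simp add: indep_var_distribution_eq)
  also have "\<dots> = (\<integral>\<^sup>+a. emeasure (distr M K B) (Pair a -` Q) \<partial>distr M N A)"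
    by (rule K.emeasure_pair_measure_alt) simp
  also have "\<dots> \<ge> (\<integral>\<^sup>+a. ennreal c \<partial>distr M N A)"
  proof (rule nn_integral_mono)
    fix a assume "a \<in> space (distr M N A)"
    then have "ennreal c \<le> emeasure M {\<omega> \<in> space M. (a, B \<omega>) \<in> Q}"
      using ge by (simp add: emeasure_eq_measure ennreal_leI)
    also have "\<dots> = emeasure (distr M K B) (Pair a -` Q)"
      by (subst emeasure_distr) (auto intro!: arg_cong[where f = "emeasure M"] sets_Pair1)
    finally show "ennreal c \<le> emeasure (distr M K B) (Pair a -` Q)" .
  qed
  finally have "ennreal c \<le> ennreal (prob {\<omega> \<in> space M. (A \<omega>, B \<omega>) \<in> Q})"
    using N.emeasure_space_1 by (simp add: emeasure_eq_measure)
  then show ?thesis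
    by (simp add: measure_nonneg)
qed

text \<open>Here the pilot estimate is a constant \<open>a\<close>. Non-coverage is the event that
  the sum of the dominated logarithms reaches the chi-squared quantile \<open>q\<close>.\<close>

lemma edelman_CS_coverage_fixed_pilot:
  assumes "prob_space M" and F: "real_distribution F"
    and uni: "unimodal_at F \<theta>" and atomless: "\<And>x. measure F {x} = 0"
    and ind: "prob_space.indep_vars M (\<lambda>_. borel) X S"
    and law: "\<And>i. i \<in> S \<Longrightarrow> distr M borel (X i) = F"
    and n: "card S = n" "1 \<le> n" and \<alpha>: "0 < \<alpha>" "\<alpha> < 1"
  shows "1 - \<alpha> \<le> measure M {\<omega> \<in> space M. \<theta> \<in> edelman_CS a S n \<alpha> (\<lambda>i. X i \<omega>)}"
proof -
  interpret prob_space M by fact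
  interpret F: real_distribution F by fact
  \<comment> \<open>An infinite set would have cardinality 0, contrary to
    \<open>1 \<le> n\<close>.\<close>
  have S: "finite S" "S \<noteq> {}"
    using n by (auto intro: card_ge_0_finite)
  define C where "C = chi_squared (2 * n)"
  define q where "q = quantile C (1 - \<alpha>)"
  have C_erlang: "C = density lborel (erlang_density (n - 1) (1 / 2))"
    unfolding C_def by (rule chi_squared_even_eq_erlang) fact
  interpret C: real_distribution C
    unfolding C_erlang real_distribution_def real_distribution_axioms_def
    by (simp add: prob_space_erlang_density)
  define Y where "Y i \<omega> = - 2 * ln (edelman_p a \<theta> (X i \<omega>))" for i \<omega>
  have rvX [measurable]: "\<And>i. i \<in> S \<Longrightarrow> random_variable borel (X i)"
    using ind by (auto simp: indep_vars_def)
  have indY: "indep_vars (\<lambda>_. borel) Y S"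
    unfolding Y_def by (rule indep_vars_compose2[OF ind]) measurable
  have sumY [measurable]: "random_variable borel (\<lambda>\<omega>. \<Sum>i\<in>S. Y i \<omega>)"
    unfolding Y_def by measurable
  have "emeasure (distr M borel (Y i)) {s..} \<le> emeasure (density lborel (exponential_density (1 / 2))) {s..}"
    if "i \<in> S" for i s
  proof -
    have "distr M borel (Y i) = distr (distr M borel (X i)) borel (\<lambda>x. - 2 * ln (edelman_p a \<theta> x))"
      using rvX[OF that] by (subst distr_distr) (auto simp: Y_def[abs_def] comp_def)
    then show ?thesis
      using F.edelman_log_upper_tail[OF uni atomless] law[OF that] by simp
  qed
  then have "emeasure (distr M borel (\<lambda>\<omega>. \<Sum>i\<in>S. Y i \<omega>)) {q..} \<le> emeasure C {q..}"
    unfolding C_erlang n(1)[symmetric] by (intro sum_indep_upper_tail_le_erlang S indY) auto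
  then have "prob {\<omega> \<in> space M. q \<le> (\<Sum>i\<in>S. Y i \<omega>)} \<le> C.prob {q..}"
    by (subst (asm) emeasure_distr)
      (auto simp: emeasure_eq_measure C.emeasure_eq_measure vimage_def Int_def conj_commute)
  also have "\<dots> = 1 - cdf C q"
  proof -
    \<comment> \<open>The strict inequality in \<open>edelman_CS\<close> makes non-coverage a closed
      tail event; as \<open>C\<close> has no atom at \<open>q\<close>, its closed tail still has
      mass \<open>1 - cdf C q\<close>.\<close>
    have "emeasure C {q} = 0"
      unfolding C_erlang by (subst emeasure_density) (auto intro!: nn_integral_null_set)
    then have "C.prob ((space C - {..q}) \<union> {q}) = C.prob (space C - {..q})"
      by (intro measure_Un_null_set) auto
    moreover have "(space C - {..q}) \<union> {q} = {q..}"
      by auto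
    ultimately show ?thesis
      using C.prob_compl[of "{..q}"] by (simp add: cdf_def)
  qed
  also have "\<dots> \<le> \<alpha>"
    using C.le_cdf_quantile[of "1 - \<alpha>"] \<alpha> by (simp add: q_def)
  finally have "prob {\<omega> \<in> space M. q \<le> (\<Sum>i\<in>S. Y i \<omega>)} \<le> \<alpha>" .
  moreover have "prob {\<omega> \<in> space M. \<not> q \<le> (\<Sum>i\<in>S. Y i \<omega>)} = 1 - prob {\<omega> \<in> space M. q \<le> (\<Sum>i\<in>S. Y i \<omega>)}"
    by (rule prob_neg) measurable
  moreover have "\<theta> \<in> edelman_CS a S n \<alpha> (\<lambda>i. X i \<omega>) \<longleftrightarrow> \<not> q \<le> (\<Sum>i\<in>S. Y i \<omega>)" for \<omega>
    by (simp add: edelman_CS_def Y_def q_def C_def not_le sum_distrib_left)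
  ultimately show ?thesis
    by simp
qed

text \<open>\<open>estimator\<close> speaks of coordinates \<open>0, ..., k - 1\<close>. The map
  \<open>r\<close> renumbers the coordinates in \<open>S\<close> by their position in the sorted
  list, and it is measurable between the product spaces.\<close>

lemma estimator_subsample_measurable:
  assumes "estimator T" "finite S"
  shows "(\<lambda>x. T (subsample S x)) \<in> borel_measurable (PiM S (\<lambda>_. borel))"
proof -
  let ?L = "sorted_list_of_set S"
  define r where "r x = (\<lambda>j\<in>{..<card S}. x (?L ! j))" for x :: "nat \<Rightarrow> real"
  have len: "length ?L = card S"
    by simp
  have L: "?L ! j \<in> S" if "j < card S" for j
    using that assms(2) nth_mem[of j ?L] by simp
  have "r \<in> measurable (PiM S (\<lambda>_. borel)) (PiM {..<card S} (\<lambda>_. borel))"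
    unfolding r_def by (rule measurable_restrict) (auto intro: measurable_component_singleton L)
  moreover have "(\<lambda>x. T (map x [0..<card S])) \<in> borel_measurable (PiM {..<card S} (\<lambda>_. borel))"
    using assms(1) by (simp add: estimator_def)
  ultimately have "(\<lambda>x. T (map (r x) [0..<card S])) \<in> borel_measurable (PiM S (\<lambda>_. borel))"
    by (rule measurable_compose)
  moreover have "map (r x) [0..<card S] = subsample S x" for x
    using len by (auto simp: subsample_def r_def intro!: nth_equalityI)
  ultimately show ?thesis
    by simp
qed

theorem theorem7:
  fixes M :: "'a measure" and X :: "nat \<Rightarrow> 'a \<Rightarrow> real"
    and F :: "real measure" and f :: "real \<Rightarrow> real"
    and \<theta>\<^sub>0 \<alpha> :: real and m n :: nat and S\<^sub>1 S\<^sub>2 :: "nat set"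
    and T :: "real list \<Rightarrow> real"
  assumes "prob_space M"
    and "real_distribution F"
    and "f \<in> borel_measurable borel" and "\<And>x. 0 \<le> f x"
    and "F = density lborel (\<lambda>x. ennreal (f x))"
    and "unimodal_at F \<theta>\<^sub>0" and "\<And>\<theta>. unimodal_at F \<theta> \<Longrightarrow> \<theta> = \<theta>\<^sub>0"
    and "prob_space.indep_vars M (\<lambda>_. borel) X {1..m}"
    and "\<And>i. i \<in> {1..m} \<Longrightarrow> distr M borel (X i) = F"
    and "S\<^sub>1 \<union> S\<^sub>2 = {1..m}" and "S\<^sub>1 \<inter> S\<^sub>2 = {}"
    and "card S\<^sub>1 = m - n" and "card S\<^sub>2 = n"
    and "\<bar>int (card S\<^sub>1) - int (card S\<^sub>2)\<bar> \<le> 1"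
    and "estimator T" and "consistent_at T F \<theta>\<^sub>0"
    and "1 \<le> n" and "0 < \<alpha>" and "\<alpha> < 1"
  shows "measure M {\<omega> \<in> space M.
           \<theta>\<^sub>0 \<in> edelman_CS (T (subsample S\<^sub>1 (\<lambda>i. X i \<omega>))) S\<^sub>2 n \<alpha> (\<lambda>i. X i \<omega>)} \<ge> 1 - \<alpha>"
proof -
  interpret prob_space M by fact
  interpret F: real_distribution F by fact
  have fin: "finite S\<^sub>1" "finite S\<^sub>2" and sub: "S\<^sub>1 \<subseteq> {1..m}" "S\<^sub>2 \<subseteq> {1..m}"
    using assms(10) finite_Un[of S\<^sub>1 S\<^sub>2] by auto
  note ind = assms(8)
  have "emeasure F {x} = 0" for x
    unfolding assms(5) using assms(3)
    by (subst emeasure_density) (auto intro!: nn_integral_null_set)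
  then have atomless: "measure F {x} = 0" for x
    by (simp add: measure_def)
  let ?P = "\<lambda>S. PiM S (\<lambda>_. borel) :: (nat \<Rightarrow> real) measure"
  let ?X = "\<lambda>S \<omega>. restrict (\<lambda>i. X i \<omega>) S"
  \<comment> \<open>The coverage event as a set of pairs of sub-samples: the first fixes the pilot
    estimate, the second supplies the p-values. Its first sections are the fixed-pilot
    events.\<close>
  define Q where "Q = {z \<in> space (?P S\<^sub>1 \<Otimes>\<^sub>M ?P S\<^sub>2).
    \<theta>\<^sub>0 \<in> edelman_CS (T (subsample S\<^sub>1 (fst z))) S\<^sub>2 n \<alpha> (snd z)}"
  note [measurable] = estimator_subsample_measurable[OF assms(15) fin(1)]
  have "Q \<in> sets (?P S\<^sub>1 \<Otimes>\<^sub>M ?P S\<^sub>2)"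
    unfolding Q_def edelman_CS_def mem_Collect_eq by measurable
  moreover have CS: "(a, ?X S\<^sub>2 \<omega>) \<in> Q \<longleftrightarrow>
      \<theta>\<^sub>0 \<in> edelman_CS (T (subsample S\<^sub>1 a)) S\<^sub>2 n \<alpha> (\<lambda>i. X i \<omega>)"
    if "a \<in> space (?P S\<^sub>1)" for a \<omega>
    using that by (simp add: Q_def edelman_CS_def space_pair_measure space_PiM)
  moreover have "1 - \<alpha> \<le> prob {\<omega> \<in> space M. (a, ?X S\<^sub>2 \<omega>) \<in> Q}" if "a \<in> space (?P S\<^sub>1)" for a
    unfolding CS[OF that]
  proof (rule edelman_CS_coverage_fixed_pilot[OF assms(1,2,6) atomless])
    show "distr M borel (X i) = F" if "i \<in> S\<^sub>2" for i
      using sub(2) that by (intro assms(9)) blast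
  qed (fact indep_vars_subset[OF ind sub(2)] assms(13,17,18,19))+
  ultimately have "1 - \<alpha> \<le> prob {\<omega> \<in> space M. (?X S\<^sub>1 \<omega>, ?X S\<^sub>2 \<omega>) \<in> Q}"
    using sub by (intro prob_indep_ge[OF indep_var_restrict[OF ind assms(11)]])
  moreover have "?X S\<^sub>1 \<omega> \<in> space (?P S\<^sub>1)" for \<omega>
    by (simp add: space_PiM)
  \<comment> \<open>Restriction, needed to land in the product space, is harmless because the pilot
    estimate reads only coordinates in \<open>S\<^sub>1\<close>.\<close>
  moreover have "subsample S\<^sub>1 (?X S\<^sub>1 \<omega>) = subsample S\<^sub>1 (\<lambda>i. X i \<omega>)" for \<omega>
    using fin by (simp add: subsample_def)
  ultimately show ?thesis
    by (simp add: CS)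
qed

end
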